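(* Let $E$ be a Polish space, $\mu$ a probability measure on $E$, and $L$ a $\mu$-symmetric diffusion operator with algebra $\mathcal{A}$ and carré du champ $\Gamma$. Suppose that there are an increasing family of exhausting sets $(A_r)_{r\ge 0}\subset E$, an $r_0>0$, a superlinear ($C^1$, positive, increasing) function $\phi$ and a smooth enough function $W\ge 1$ such that for some $b>0$ the following Lyapunov condition holds: $$LW\le-\phi(W)+b\,\mathbf{1}_{A_{r_0}} .$$ Assume in addition that a local super Poincaré inequality holds, i.e. there exists $\beta_{loc}(r,s)$, decreasing in $s$ (for all $r$), such that for all $r$, all $s>0$ and all nice $f$ $$\int_{A_r}f^2\,d\mu\le s\int\Gamma(f)\,d\mu+\beta_{loc}(r,s)\Big(\int_{A_r}|f|\,d\mu\Big)^2 .$$ Then, if $$G(r):=\Big(\inf_{A_r^c}\frac{\phi(W)}{W}\Big)^{-1}$$ tends to $0$ as $r\to\infty$, $\mu$ satisfies, for all positive $s$ and all nice $f$, $$\int f^2\,d\mu\le 2s\int\Gamma(f)\,d\mu+\tilde\beta(s)\Big(\int|f|\,d\mu\Big)^2,$$ where $$\tilde\beta(s)=c_{r_0}\,\beta_{loc}\big(G^{-1}(s),\,s/c_{r_0}\big)\qquad\text{and}\qquad c_{r_0}=1+b\,\frac{\sup_{A_{r_0}}W}{\inf_{A_{r_0}^c}\phi(W)/W}.$$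
   Context: Setting: $L$ is a $\mu$-symmetric operator, and there is an algebra $\mathcal{A}$ of bounded functions (the "nice" functions), containing the constant functions, which is everywhere dense (in the $L^2(\mu)$ norm) in the domain of $L$. The carré du champ $\Gamma$ is defined for $f,g\in\mathcal{A}$ by $L(fg)=fLg+gLf+2\Gamma(f,g)$, and $\Gamma(f):=\Gamma(f,f)$. It is assumed that $\Gamma$ is a derivation in each component, $\Gamma(fg,h)=f\Gamma(g,h)+g\Gamma(f,h)$ (diffusion case), so that the chain rule $\Gamma(\Psi(f),\Phi(g))=\Psi'(f)\Phi'(g)\Gamma(f,g)$ holds. $A_r^c$ is the complement of $A_r$ in $E$, and $G^{-1}$ denotes the inverse function of $G$.
   Formalization: G^{-1}(s) is any r ≥ r_0 with G(r)=s, or G(r) ≤ s if s is not a value of G on [r_0,∞); with G^{-1}(s)<r_0 the claim can fail (A_0 empty, f=1). Also Γ(f) ≥ 0 and sup_{A_{r_0}} W<∞ are assumed, and "smooth enough" means W agrees with an element of the algebra on each set {W ≤ n}. *)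

theory Defs
  imports "HOL-Probability.Probability"
begin

definition square_integrable :: "'a measure \<Rightarrow> ('a \<Rightarrow> real) set" where
  "square_integrable M = {f \<in> borel_measurable M. integrable M (\<lambda>x. (f x)\<^sup>2)}"

definition smooth :: "(real \<Rightarrow> real) \<Rightarrow> bool" where
  "smooth \<Psi> \<longleftrightarrow> (\<forall>k x. ((deriv ^^ k) \<Psi>) differentiable (at x))"

definition carre_du_champ ::
  "(('a \<Rightarrow> real) \<Rightarrow> 'a \<Rightarrow> real) \<Rightarrow> ('a \<Rightarrow> real) \<Rightarrow> ('a \<Rightarrow> real) \<Rightarrow> 'a \<Rightarrow> real" where
  "carre_du_champ L f g x = (L (\<lambda>y. f y * g y) x - f x * L g x - g x * L f x) / 2"

text \<open>
  An operator on \<open>L\<^sup>2\<close> is represented by a map on functions that is compatible with almost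
  everywhere equality; identities between its values are therefore stated almost everywhere.
\<close>

locale symmetric_operator = prob_space M
  for M :: "'a::polish_space measure" +
  fixes D :: "('a \<Rightarrow> real) set" and L :: "('a \<Rightarrow> real) \<Rightarrow> 'a \<Rightarrow> real"
  assumes sets_borel: "sets M = sets borel"
    and D_L2: "D \<subseteq> square_integrable M"
    and L_L2: "f \<in> D \<Longrightarrow> L f \<in> square_integrable M"
    and D_add: "f \<in> D \<Longrightarrow> g \<in> D \<Longrightarrow> (\<lambda>x. f x + g x) \<in> D"
    and D_scale: "f \<in> D \<Longrightarrow> (\<lambda>x. a * f x) \<in> D"
    and L_cong: "f \<in> D \<Longrightarrow> g \<in> D \<Longrightarrow> AE x in M. f x = g x \<Longrightarrow> AE x in M. L f x = L g x"
    and L_add: "f \<in> D \<Longrightarrow> g \<in> D \<Longrightarrow> AE x in M. L (\<lambda>y. f y + g y) x = L f x + L g x"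
    and L_scale: "f \<in> D \<Longrightarrow> AE x in M. L (\<lambda>y. a * f y) x = a * L f x"
    and L_symmetric: "f \<in> D \<Longrightarrow> g \<in> D \<Longrightarrow> (LINT x|M. f x * L g x) = (LINT x|M. g x * L f x)"

locale symmetric_diffusion = symmetric_operator M D L
  for M :: "'a::polish_space measure" and D :: "('a \<Rightarrow> real) set"
    and L :: "('a \<Rightarrow> real) \<Rightarrow> 'a \<Rightarrow> real" +
  fixes \<A> :: "('a \<Rightarrow> real) set"
  assumes alg_D: "\<A> \<subseteq> D"
    and alg_bounded: "f \<in> \<A> \<Longrightarrow> bounded (range f)"
    and alg_const: "(\<lambda>_. a) \<in> \<A>"
    and alg_add: "f \<in> \<A> \<Longrightarrow> g \<in> \<A> \<Longrightarrow> (\<lambda>x. f x + g x) \<in> \<A>"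
    and alg_mult: "f \<in> \<A> \<Longrightarrow> g \<in> \<A> \<Longrightarrow> (\<lambda>x. f x * g x) \<in> \<A>"
    and alg_dense: "f \<in> D \<Longrightarrow> \<epsilon> > 0 \<Longrightarrow> \<exists>g\<in>\<A>. sqrt (LINT x|M. (f x - g x)\<^sup>2) < \<epsilon>"
    and Gamma_nonneg: "f \<in> \<A> \<Longrightarrow> AE x in M. 0 \<le> carre_du_champ L f f x"
    and Gamma_derivation: "f \<in> \<A> \<Longrightarrow> g \<in> \<A> \<Longrightarrow> h \<in> \<A> \<Longrightarrow>
      AE x in M. carre_du_champ L (\<lambda>y. f y * g y) h x
        = f x * carre_du_champ L g h x + g x * carre_du_champ L f h x"
    and alg_comp: "f \<in> \<A> \<Longrightarrow> smooth \<Psi> \<Longrightarrow> (\<lambda>x. \<Psi> (f x)) \<in> \<A>"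
    and Gamma_chain: "f \<in> \<A> \<Longrightarrow> g \<in> \<A> \<Longrightarrow> smooth \<Psi> \<Longrightarrow> smooth \<Phi> \<Longrightarrow>
      AE x in M. carre_du_champ L (\<lambda>y. \<Psi> (f y)) (\<lambda>y. \<Phi> (g y)) x
        = deriv \<Psi> (f x) * deriv \<Phi> (g x) * carre_du_champ L f g x"

text \<open>
  A Lyapunov function is typically unbounded, hence not itself in \<open>\<A>\<close>. It is ``smooth enough''
  if it is locally in \<open>\<A>\<close>: below every level it coincides with an element \<open>V\<close> of \<open>\<A>\<close> (a
  truncation of \<open>W\<close>). Then \<open>LW\<close> is the function that agrees with \<open>L V\<close> below that level.
\<close>

definition locally_in_algebra ::
  "'a measure \<Rightarrow> (('a \<Rightarrow> real) \<Rightarrow> 'a \<Rightarrow> real) \<Rightarrow> ('a \<Rightarrow> real) set \<Rightarrow> ('a \<Rightarrow> real) \<Rightarrow> ('a \<Rightarrow> real) \<Rightarrow> bool"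
  where
  "locally_in_algebra M L \<A> W LW \<longleftrightarrow>
    (\<forall>n::nat. \<exists>V\<in>\<A>. (\<forall>x. W x \<le> real n \<longrightarrow> V x = W x) \<and> (\<forall>x. W x > real n \<longrightarrow> V x \<ge> real n) \<and>
      (AE x in M. W x \<le> real n \<longrightarrow> L V x = LW x))"

text \<open>Only values on \<open>[1,\<infinity>)\<close> matter, since \<open>\<phi>\<close> is evaluated at \<open>W \<ge> 1\<close>.\<close>

definition superlinear :: "(real \<Rightarrow> real) \<Rightarrow> bool" where
  "superlinear \<phi> \<longleftrightarrow>
    (\<exists>\<phi>'. continuous_on {1..} \<phi>' \<and>
      (\<forall>w\<ge>1. (\<phi> has_real_derivative \<phi>' w) (at w within {1..}))) \<and>
    (\<forall>w\<ge>1. \<phi> w > 0) \<and> mono_on {1..} \<phi> \<and> filterlim (\<lambda>w. \<phi> w / w) at_top at_top"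

text \<open>
  The infimum is taken in \<open>[0,\<infinity>]\<close>, so it is \<open>\<infinity>\<close> (and its inverse \<open>0\<close>) when \<open>S\<close> is everything.
\<close>

definition inf_outside :: "(real \<Rightarrow> real) \<Rightarrow> ('a \<Rightarrow> real) \<Rightarrow> 'a set \<Rightarrow> ennreal" where
  "inf_outside \<phi> W S = (INF x\<in>-S. ennreal (\<phi> (W x) / W x))"

definition rate_G :: "(real \<Rightarrow> real) \<Rightarrow> ('a \<Rightarrow> real) \<Rightarrow> (real \<Rightarrow> 'a set) \<Rightarrow> real \<Rightarrow> ennreal" where
  "rate_G \<phi> W A r = inverse (inf_outside \<phi> W (A r))"

definition const_c :: "(real \<Rightarrow> real) \<Rightarrow> ('a \<Rightarrow> real) \<Rightarrow> real \<Rightarrow> 'a set \<Rightarrow> real" where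
  "const_c \<phi> W b S = 1 + enn2real (ennreal b * (SUP x\<in>S. ennreal (W x)) / inf_outside \<phi> W S)"

text \<open>
  \<open>H\<close> is an inverse of the nonincreasing function \<open>G\<close> on \<open>[r0,\<infinity>)\<close>, defined at every \<open>s > 0\<close>:
  \<open>H s\<close> is a preimage of \<open>s\<close> whenever there is one. A positive \<open>s\<close> without preimage (above \<open>G r0\<close>,
  or in a jump of \<open>G\<close>) is sent to a point where \<open>G\<close> is below \<open>s\<close>. When \<open>G\<close> is right-continuous,
  the generalized inverse \<open>Inf {r. r0 \<le> r \<and> G r \<le> s}\<close> is one such \<open>H\<close>.
\<close>

definition inverse_from :: "real \<Rightarrow> (real \<Rightarrow> ennreal) \<Rightarrow> (real \<Rightarrow> real) \<Rightarrow> bool" where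
  "inverse_from r0 G H \<longleftrightarrow>
    (\<forall>s>0. r0 \<le> H s \<and> G (H s) \<le> ennreal s \<and> (ennreal s \<in> G ` {r0..} \<longrightarrow> G (H s) = ennreal s))"

end

theory Submission
  imports Defs
begin

text \<open>
  The key estimate is \<open>\<integral> f\<^sup>2 \<phi>(W)/W \<le> \<integral> \<Gamma>(f) + b \<integral>\<^bsub>A r0\<^esub> f\<^sup>2\<close>. Formally, by symmetry and the chain
  rule, \<open>\<integral> f\<^sup>2 (-LW)/W = \<integral> (2 (f/W) \<Gamma>(f,W) - (f/W)\<^sup>2 \<Gamma>(W)) \<le> \<integral> \<Gamma>(f)\<close>, the last step being positivity
  of \<open>\<Gamma>(f - t W)\<close> at \<open>t = f/W\<close>. As \<open>W\<close> is only locally in the algebra, \<open>1/W\<close> is replaced by \<open>\<psi>(V)\<close>,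
  where \<open>V\<close> is the truncation of \<open>W\<close> at level \<open>n\<close> and \<open>\<psi>\<close> vanishes above \<open>n\<close> and satisfies
  \<open>\<psi>' \<le> - \<psi>\<^sup>2\<close>; then \<open>n\<close> tends to infinity.

  Outside \<open>A r\<close> one has \<open>1 \<le> G(r) \<phi>(W)/W\<close>, so the integral of \<open>f\<^sup>2\<close> there is at most
  \<open>G(r) (\<integral> \<Gamma>(f) + b \<integral>\<^bsub>A r0\<^esub> f\<^sup>2)\<close>, and the local inequality takes care of \<open>A r\<close>. Enlarging
  \<open>\<integral>\<^bsub>A r\<^esub> \<bar>f\<bar>\<close> to \<open>\<integral> \<bar>f\<bar>\<close> requires \<open>\<beta>loc \<ge> 0\<close>: the key estimate for \<open>f = 1\<close> gives
  \<open>\<mu>(A r0) > 0\<close>, whence the local inequality for \<open>f = 1\<close> forces \<open>\<beta>loc > 0\<close>.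
\<close>

section \<open>Polynomial approximation in the \<open>C^1\<close> norm and integrability under
  bounded factors\<close>

lemma smooth_poly: "smooth (poly p)"
proof -
  have "(deriv ^^ k) (poly p) = poly ((pderiv ^^ k) p)" for k
  proof (induction k)
    case (Suc k)
    show ?case
      by (simp add: Suc) (auto intro!: ext DERIV_imp_deriv)
  qed simp
  then show ?thesis
    by (simp add: smooth_def)
qed

text \<open>The Weierstrass theorem is applied to \<open>f'\<close>. The antiderivative of the
  resulting polynomial, shifted to agree with \<open>f\<close> at \<open>a\<close>, is close to
  \<open>f\<close> because the mean value inequality bounds the difference by the derivative error
  times the length of the interval.\<close>

lemma C1_polynomial_approximation:
  fixes f f' :: "real \<Rightarrow> real"
  assumes ac: "a \<le> c"
    and deriv: "\<And>x. x \<in> {a..c} \<Longrightarrow> (f has_real_derivative f' x) (at x within {a..c})"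
    and cont: "continuous_on {a..c} f'" and "e > 0"
  obtains p where "\<And>x. x \<in> {a..c} \<Longrightarrow> \<bar>f x - poly p x\<bar> \<le> e"
    "\<And>x. x \<in> {a..c} \<Longrightarrow> \<bar>f' x - poly (pderiv p) x\<bar> \<le> e"
proof -
  \<comment> \<open>In the denominator, \<open>1\<close> secures \<open>d \<le> e\<close> and
    \<open>c - a\<close> secures \<open>d * (c - a) \<le> e\<close>.\<close>
  define d where "d = e / (1 + (c - a))"
  have d: "d > 0" "d \<le> e" "d * (c - a) \<le> e"
    using \<open>e > 0\<close> ac by (auto simp: d_def field_simps)
  obtain q where q: "real_polynomial_function q" "\<And>x. x \<in> {a..c} \<Longrightarrow> \<bar>f' x - q x\<bar> < d"
    using Stone_Weierstrass_real_polynomial_function[OF _ cont d(1)] by blast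
  obtain k n where kn: "q = (\<lambda>x. \<Sum>i\<le>n. k i * x ^ i)"
    using q(1) real_polynomial_function_iff_sum by blast
  define P where "P = (\<Sum>i\<le>n. monom (k i / real (Suc i)) (Suc i))"
  define p where "p = P + [:f a - poly P a:]"
  have "pderiv P = (\<Sum>i\<le>n. monom (k i) i)"
    using higher_pderiv_sum[of 1 "\<lambda>i. monom (k i / real (Suc i)) (Suc i)" "{..n}"]
    by (simp add: P_def pderiv_monom del: of_nat_Suc)
  then have "pderiv p = (\<Sum>i\<le>n. monom (k i) i)"
    by (simp add: p_def pderiv_add pderiv_pCons)
  then have dp: "poly (pderiv p) = q"
    by (auto simp: kn poly_sum poly_monom)
  have "norm ((f x - poly p x) - (f a - poly p a)) \<le> d * norm (x - a)" if x: "x \<in> {a..c}" for x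
  proof (rule field_differentiable_bound)
    show "((\<lambda>x. f x - poly p x) has_real_derivative f' z - q z) (at z within {a..c})"
      if "z \<in> {a..c}" for z
      using DERIV_diff[OF deriv[OF that] DERIV_subset[OF poly_DERIV[of p z]]] by (simp add: dp)
    show "norm (f' z - q z) \<le> d" if "z \<in> {a..c}" for z
      using q(2)[OF that] by simp
  qed (use x ac in auto)
  moreover have "poly p a = f a"
    by (simp add: p_def)
  moreover have "d * norm (x - a) \<le> e" if x: "x \<in> {a..c}" for x
  proof -
    have "d * norm (x - a) \<le> d * (c - a)"
      using x d by (intro mult_left_mono) auto
    then show ?thesis using d by linarith
  qed
  ultimately have "\<bar>f x - poly p x\<bar> \<le> e" if "x \<in> {a..c}" for x
    using that by (metis (no_types) diff_self diff_zero order_trans real_norm_def)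
  moreover have "\<bar>f' x - poly (pderiv p) x\<bar> \<le> e" if "x \<in> {a..c}" for x
    using q(2)[OF that] d dp by simp
  ultimately show ?thesis using that by blast
qed

lemma integrable_bounded_mult:
  fixes X g :: "'a \<Rightarrow> real"
  assumes "integrable M X" "g \<in> borel_measurable M" "bounded (range g)"
  shows "integrable M (\<lambda>x. g x * X x)"
proof -
  obtain B where B: "\<And>x. \<bar>g x\<bar> \<le> B"
    using assms(3) unfolding bounded_iff by auto
  show ?thesis
  proof (rule Bochner_Integration.integrable_bound)
    show "integrable M (\<lambda>x. B * X x)" using assms by simp
    have "\<bar>B\<bar> \<ge> \<bar>g x\<bar>" for x using B[of x] by linarith
    then show "AE x in M. norm (g x * X x) \<le> norm (B * X x)"
      by (auto simp: abs_mult intro!: mult_right_mono)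
  qed (use assms in measurable)
qed

lemma measurable_continuous_on_comp:
  fixes V :: "'a \<Rightarrow> real" and \<psi> :: "real \<Rightarrow> real"
  assumes "V \<in> borel_measurable M" "\<And>x. V x \<in> S" "continuous_on S \<psi>"
  shows "(\<lambda>x. \<psi> (V x)) \<in> borel_measurable M"
proof (rule measurable_compose[OF _ borel_measurable_continuous_on_restrict[OF assms(3)]])
  show "V \<in> M \<rightarrow>\<^sub>M restrict_space borel S"
    using assms by (intro measurable_restrict_space2) auto
qed

section \<open>Integration by parts and positivity for \<open>\<Gamma>\<close> on the
  algebra\<close>

context symmetric_diffusion
begin

abbreviation \<Gamma> where "\<Gamma> \<equiv> carre_du_champ L"

lemma alg_measurable: "f \<in> \<A> \<Longrightarrow> f \<in> borel_measurable M"
  using alg_D D_L2 by (auto simp: square_integrable_def)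

lemma alg_bound:
  assumes "f \<in> \<A>" obtains B where "\<And>x. \<bar>f x\<bar> \<le> B"
  using alg_bounded[OF assms] unfolding bounded_iff by auto

lemma L_integrable:
  assumes "f \<in> \<A>" shows "integrable M (L f)"
proof -
  have "L f \<in> square_integrable M"
    using L_L2 alg_D assms by blast
  then show ?thesis
    by (simp add: square_integrable_def square_integrable_imp_integrable)
qed

lemma alg_integrable_mult: "f \<in> \<A> \<Longrightarrow> integrable M X \<Longrightarrow> integrable M (\<lambda>x. f x * X x)"
  for X :: "'a \<Rightarrow> real"
  by (intro integrable_bounded_mult alg_measurable alg_bounded)

lemma alg_integrable: "f \<in> \<A> \<Longrightarrow> integrable M f"
  using alg_integrable_mult[of f "\<lambda>_. 1"] by simp

lemma Gamma_integrable:
  assumes "f \<in> \<A>" "g \<in> \<A>" shows "integrable M (\<Gamma> f g)"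
proof -
  have "integrable M (\<lambda>x. (L (\<lambda>y. f y * g y) x - f x * L g x - g x * L f x) / 2)"
    using assms by (intro integrable_divide_zero Bochner_Integration.integrable_diff
        alg_integrable_mult L_integrable alg_mult) auto
  then show ?thesis
    by (simp add: carre_du_champ_def[abs_def])
qed

text \<open>The derivation rule at constants reads \<open>\<Gamma>(1,1) = 2 \<Gamma>(1,1)\<close>,
  so \<open>\<Gamma>(1,1)\<close> vanishes, while by definition it is
  \<open>- L 1 / 2\<close>.\<close>

lemma L_one: "AE x in M. L (\<lambda>_. 1) x = 0"
  using Gamma_derivation[OF alg_const[of 1] alg_const[of 1] alg_const[of 1]]
  by eventually_elim (simp add: carre_du_champ_def)

text \<open>Invariance of \<open>M\<close>: symmetry moves \<open>L\<close> from \<open>f\<close>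
  onto the constant \<open>1\<close>, where it vanishes.\<close>

lemma integral_L: assumes "f \<in> \<A>" shows "(LINT x|M. L f x) = 0"
proof -
  have "(LINT x|M. 1 * L f x) = (LINT x|M. f x * L (\<lambda>_. 1) x)"
    using assms alg_const[of 1] alg_D by (intro L_symmetric) auto
  also have "\<dots> = (LINT x|M. 0)"
    using assms L_one alg_measurable[OF assms] L_integrable[OF alg_const[of 1]]
    by (intro integral_cong_AE) auto
  finally show ?thesis by simp
qed

text \<open>The term \<open>L(f g)\<close> integrates to zero by invariance, and symmetry makes the
  two remaining terms equal.\<close>

lemma integral_Gamma:
  assumes "f \<in> \<A>" "g \<in> \<A>"
  shows "(LINT x|M. \<Gamma> f g x) = - (LINT x|M. f x * L g x)"
proof -
  have "(LINT x|M. f x * L g x) = (LINT x|M. g x * L f x)"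
    using assms alg_D by (intro L_symmetric) auto
  moreover have "(LINT x|M. \<Gamma> f g x)
      = ((LINT x|M. L (\<lambda>y. f y * g y) x) - (LINT x|M. f x * L g x) - (LINT x|M. g x * L f x)) / 2"
    using assms unfolding carre_du_champ_def
    by (simp add: alg_integrable_mult L_integrable alg_mult)
  ultimately show ?thesis
    using integral_L[OF alg_mult[OF assms]] by simp
qed

text \<open>
  The chain rule is available for smooth functions only; approximating \<open>\<psi>\<close> by polynomials in the
  \<open>C\<^sup>1\<close> norm on the range of \<open>V\<close> extends the integrated form to all \<open>C\<^sup>1\<close> functions.
\<close>

lemma integral_by_parts_C1:
  fixes \<psi> \<psi>' :: "real \<Rightarrow> real"
  assumes u: "u \<in> \<A>" and V: "V \<in> \<A>" and rng: "\<And>x. V x \<in> {a..c}"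
    and deriv: "\<And>v. v \<in> {a..c} \<Longrightarrow> (\<psi> has_real_derivative \<psi>' v) (at v within {a..c})"
    and cont: "continuous_on {a..c} \<psi>'"
  shows "integrable M (\<lambda>x. u x * \<psi> (V x) * L V x)"
    and "integrable M (\<lambda>x. \<psi> (V x) * \<Gamma> u V x + u x * \<psi>' (V x) * \<Gamma> V V x)"
    and "(LINT x|M. u x * \<psi> (V x) * L V x)
      = - (LINT x|M. \<psi> (V x) * \<Gamma> u V x + u x * \<psi>' (V x) * \<Gamma> V V x)"
proof -
  have ac: "a \<le> c" using rng[of undefined] by auto
  have c\<psi>: "continuous_on {a..c} \<psi>" using deriv by (rule DERIV_continuous_on)
  have *: "integrable M (\<lambda>x. h (V x) * X x)"
    if "continuous_on {a..c} h" "integrable M X" for h :: "real \<Rightarrow> real" and X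
  proof (rule integrable_bounded_mult[OF that(2)])
    show "(\<lambda>x. h (V x)) \<in> borel_measurable M"
      using measurable_continuous_on_comp[OF alg_measurable[OF V] rng that(1)] .
    have "bounded (h ` {a..c})"
      using compact_continuous_image[OF that(1)] compact_imp_bounded by blast
    then show "bounded (range (\<lambda>x. h (V x)))"
      by (rule bounded_subset) (use rng in auto)
  qed
  have iL: "integrable M (\<lambda>x. u x * L V x)" and iG: "integrable M (\<Gamma> u V)"
    and iV: "integrable M (\<lambda>x. u x * \<Gamma> V V x)"
    using u V by (auto intro!: alg_integrable_mult L_integrable Gamma_integrable)
  show i1: "integrable M (\<lambda>x. u x * \<psi> (V x) * L V x)"
    using *[OF c\<psi> iL] by (simp add: mult_ac)
  show i2: "integrable M (\<lambda>x. \<psi> (V x) * \<Gamma> u V x + u x * \<psi>' (V x) * \<Gamma> V V x)"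
    using Bochner_Integration.integrable_add[OF *[OF c\<psi> iG] *[OF cont iV]] by (simp add: mult_ac)
  define F where "F x = u x * \<psi> (V x) * L V x + (\<psi> (V x) * \<Gamma> u V x + u x * \<psi>' (V x) * \<Gamma> V V x)" for x
  have iF: "integrable M F" unfolding F_def using i1 i2 by simp
  \<comment> \<open>\<open>Y\<close> is an integrable majorant independent of the approximating
    polynomial: changing \<open>\<psi>\<close> and \<open>\<psi>'\<close> by at most
    \<open>e\<close> changes \<open>F\<close> by at most \<open>e * Y\<close>.\<close>
  define Y where "Y x = \<bar>u x * L V x\<bar> + \<bar>\<Gamma> u V x\<bar> + \<bar>u x * \<Gamma> V V x\<bar>" for x
  have iY: "integrable M Y" unfolding Y_def using iL iG iV by auto
  have bound: "\<bar>LINT x|M. F x\<bar> \<le> e * (LINT x|M. Y x)" if e: "e > 0" for e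
  proof -
    obtain p where p: "\<And>v. v \<in> {a..c} \<Longrightarrow> \<bar>\<psi> v - poly p v\<bar> \<le> e"
        "\<And>v. v \<in> {a..c} \<Longrightarrow> \<bar>\<psi>' v - poly (pderiv p) v\<bar> \<le> e"
      using C1_polynomial_approximation[OF ac deriv cont e] by blast
    have pV: "(\<lambda>y. poly p (V y)) \<in> \<A>" using alg_comp[OF V smooth_poly] .
    have dp: "deriv (poly q) = poly (pderiv q)" for q :: "real poly"
      by (auto intro!: DERIV_imp_deriv)
    \<comment> \<open>Only the first argument of \<open>\<Gamma>\<close> is a composition, so the
      chain rule is used with the identity, written as a polynomial, in the second.\<close>
    have poly_id: "poly [:0, 1:] = (\<lambda>v. v :: real)" by auto
    have "AE x in M. \<Gamma> (\<lambda>y. poly p (V y)) V x = poly (pderiv p) (V x) * \<Gamma> V V x"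
      using Gamma_chain[OF V V smooth_poly[of p] smooth_poly[of "[:0, 1:]"]]
      unfolding dp unfolding poly_id by (simp add: pderiv_pCons)
    moreover note Gamma_derivation[OF u pV V]
    ultimately have ae: "AE x in M. \<Gamma> (\<lambda>y. u y * poly p (V y)) V x
        = poly p (V x) * \<Gamma> u V x + u x * poly (pderiv p) (V x) * \<Gamma> V V x"
      by eventually_elim simp
    define Fp where "Fp x = u x * poly p (V x) * L V x
        + (poly p (V x) * \<Gamma> u V x + u x * poly (pderiv p) (V x) * \<Gamma> V V x)" for x
    have j1: "integrable M (\<lambda>x. u x * poly p (V x) * L V x)"
      using *[OF continuous_on_poly[OF continuous_on_id] iL, of p] by (simp add: mult_ac)
    have j2: "integrable M (\<lambda>x. poly p (V x) * \<Gamma> u V x + u x * poly (pderiv p) (V x) * \<Gamma> V V x)"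
      using Bochner_Integration.integrable_add[OF
          *[OF continuous_on_poly[OF continuous_on_id] iG, of p]
          *[OF continuous_on_poly[OF continuous_on_id] iV, of "pderiv p"]]
      by (simp add: mult_ac)
    \<comment> \<open>For polynomial weights the formula is exact, since \<open>u * poly p V\<close>
      lies in the algebra and \<open>integral_Gamma\<close> applies to it.\<close>
    have "(LINT x|M. poly p (V x) * \<Gamma> u V x + u x * poly (pderiv p) (V x) * \<Gamma> V V x)
        = (LINT x|M. \<Gamma> (\<lambda>y. u y * poly p (V y)) V x)"
      using ae j2 Gamma_integrable[OF alg_mult[OF u pV] V]
      by (intro integral_cong_AE borel_measurable_integrable) auto
    also have "\<dots> = - (LINT x|M. u x * poly p (V x) * L V x)"
      using integral_Gamma[OF alg_mult[OF u pV] V] .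
    finally have Fp0: "(LINT x|M. Fp x) = 0"
      unfolding Fp_def using j1 j2 by simp
    have iFp: "integrable M Fp" unfolding Fp_def using j1 j2 by simp
    have "\<bar>F x - Fp x\<bar> \<le> e * Y x" for x
    proof -
      define d1 d2 where "d1 = \<psi> (V x) - poly p (V x)" and "d2 = \<psi>' (V x) - poly (pderiv p) (V x)"
      have d: "\<bar>d1\<bar> \<le> e" "\<bar>d2\<bar> \<le> e" using p rng by (auto simp: d1_def d2_def)
      have "F x - Fp x = d1 * (u x * L V x) + d1 * \<Gamma> u V x + d2 * (u x * \<Gamma> V V x)"
        by (simp add: F_def Fp_def d1_def d2_def algebra_simps)
      also have "\<bar>\<dots>\<bar> \<le> \<bar>d1\<bar> * \<bar>u x * L V x\<bar> + \<bar>d1\<bar> * \<bar>\<Gamma> u V x\<bar> + \<bar>d2\<bar> * \<bar>u x * \<Gamma> V V x\<bar>"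
        unfolding abs_mult[symmetric] by linarith
      also have "\<dots> \<le> e * \<bar>u x * L V x\<bar> + e * \<bar>\<Gamma> u V x\<bar> + e * \<bar>u x * \<Gamma> V V x\<bar>"
        using d by (intro add_mono mult_right_mono) auto
      finally show ?thesis by (simp add: Y_def algebra_simps)
    qed
    then have "\<bar>LINT x|M. F x - Fp x\<bar> \<le> (LINT x|M. e * Y x)"
      using iF iFp iY by (intro integral_abs_bound[THEN order_trans] integral_mono) auto
    then show ?thesis using Fp0 iF iFp by simp
  qed
  have "\<bar>LINT x|M. F x\<bar> \<le> 0"
  proof (rule field_le_epsilon)
    fix e :: real assume "e > 0"
    have Y0: "(LINT x|M. Y x) \<ge> 0" by (rule integral_nonneg_AE) (auto simp: Y_def)
    have "\<bar>LINT x|M. F x\<bar> \<le> e / (1 + (LINT x|M. Y x)) * (LINT x|M. Y x)"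
      using \<open>e > 0\<close> Y0 by (intro bound divide_pos_pos) auto
    also have "\<dots> \<le> e" using \<open>e > 0\<close> Y0 by (simp add: field_simps)
    finally show "\<bar>LINT x|M. F x\<bar> \<le> 0 + e" by simp
  qed
  then show "(LINT x|M. u x * \<psi> (V x) * L V x)
      = - (LINT x|M. \<psi> (V x) * \<Gamma> u V x + u x * \<psi>' (V x) * \<Gamma> V V x)"
    unfolding F_def using i1 i2 by simp
qed

text \<open>Expansion of \<open>\<Gamma>(f + t g) \<ge> 0\<close>. The quantifier over
  \<open>t\<close> stands inside the almost-everywhere statement so that \<open>t\<close> may later
  depend on \<open>x\<close>. Each \<open>t\<close> has its own null set, so rational
  \<open>t\<close> come first and continuity in \<open>t\<close> gives the rest.\<close>

lemma Gamma_quadratic_nonneg: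
  assumes f: "f \<in> \<A>" and g: "g \<in> \<A>"
  shows "AE x in M. \<forall>t. 0 \<le> \<Gamma> f f x + 2 * t * \<Gamma> f g x + t\<^sup>2 * \<Gamma> g g x"
proof -
  have rat: "AE x in M. 0 \<le> \<Gamma> f f x + 2 * q * \<Gamma> f g x + q\<^sup>2 * \<Gamma> g g x" for q
  proof -
    let ?h = "\<lambda>y. q * g y" and ?s = "\<lambda>y. f y + q * g y"
    have h: "?h \<in> \<A>" using alg_mult[OF alg_const g] .
    have s: "?s \<in> \<A>" using alg_add[OF f h] .
    have DA: "k \<in> D" if "k \<in> \<A>" for k using that alg_D by auto
    have ff: "(\<lambda>y. f y * f y) \<in> \<A>" and fg: "(\<lambda>y. f y * g y) \<in> \<A>" and gg: "(\<lambda>y. g y * g y) \<in> \<A>"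
      using f g alg_mult by auto
    have fg': "(\<lambda>y. 2 * q * (f y * g y)) \<in> \<A>" and gg': "(\<lambda>y. q\<^sup>2 * (g y * g y)) \<in> \<A>"
      using alg_mult[OF alg_const fg] alg_mult[OF alg_const gg] by auto
    have eq: "(\<lambda>y. ?s y * ?s y) = (\<lambda>y. f y * f y + (2 * q * (f y * g y) + q\<^sup>2 * (g y * g y)))"
      by (auto simp: algebra_simps power2_eq_square)
    have "AE x in M. L (\<lambda>y. ?s y * ?s y) x
        = L (\<lambda>y. f y * f y) x + L (\<lambda>y. 2 * q * (f y * g y) + q\<^sup>2 * (g y * g y)) x"
      unfolding eq by (rule L_add[OF DA[OF ff] DA[OF alg_add[OF fg' gg']]])
    moreover note L_add[OF DA[OF fg'] DA[OF gg']] L_scale[OF DA[OF fg], of "2 * q"]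
      L_scale[OF DA[OF gg], of "q\<^sup>2"] L_add[OF DA[OF f] DA[OF h]] L_scale[OF DA[OF g], of q]
      Gamma_nonneg[OF s]
    ultimately show ?thesis
    proof eventually_elim
      case (elim x)
      have "\<Gamma> ?s ?s x = \<Gamma> f f x + 2 * q * \<Gamma> f g x + q\<^sup>2 * \<Gamma> g g x"
        unfolding carre_du_champ_def elim(1-6) by (simp add: field_simps power2_eq_square)
      then show ?case using elim(7) by simp
    qed
  qed
  have "AE x in M. \<forall>q\<in>\<rat>. 0 \<le> \<Gamma> f f x + 2 * q * \<Gamma> f g x + q\<^sup>2 * \<Gamma> g g x"
    using rat by (subst AE_ball_countable) (auto intro: countable_rat)
  then show ?thesis
  proof eventually_elim
    case (elim x)
    have "closed {t. 0 \<le> \<Gamma> f f x + 2 * t * \<Gamma> f g x + t\<^sup>2 * \<Gamma> g g x}"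
      by (intro closed_Collect_le continuous_intros)
    then have "closure \<rat> \<subseteq> {t. 0 \<le> \<Gamma> f f x + 2 * t * \<Gamma> f g x + t\<^sup>2 * \<Gamma> g g x}"
      using elim by (intro closure_minimal) auto
    then show ?case by (auto simp: Rats_closure_real)
  qed
qed

text \<open>Integration by parts turns the left side into the integral of
  \<open>2 f \<psi> \<Gamma>(f,V) + f^2 \<psi>' \<Gamma>(V)\<close>. Replacing
  \<open>\<psi>'\<close> by its bound \<open>- \<psi>^2\<close> and completing the square pointwise,
  at \<open>t = - f \<psi>(V)\<close>, leaves at most \<open>\<Gamma>(f)\<close>.\<close>

lemma integral_L_weight_le_Gamma:
  assumes f: "f \<in> \<A>" and V: "V \<in> \<A>" and rng: "\<And>x. V x \<in> {a..c}"
    and deriv: "\<And>v. v \<in> {a..c} \<Longrightarrow> (\<psi> has_real_derivative \<psi>' v) (at v within {a..c})"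
    and cont: "continuous_on {a..c} \<psi>'"
    and riccati: "\<And>v. v \<in> {a..c} \<Longrightarrow> \<psi>' v \<le> - (\<psi> v)\<^sup>2"
  shows "(LINT x|M. (f x)\<^sup>2 * \<psi> (V x) * - L V x) \<le> (LINT x|M. \<Gamma> f f x)"
proof -
  have ff: "(\<lambda>y. (f y)\<^sup>2) \<in> \<A>" using alg_mult[OF f f] by (simp add: power2_eq_square)
  note parts = integral_by_parts_C1[OF ff V rng deriv cont]
  have "(LINT x|M. (f x)\<^sup>2 * \<psi> (V x) * - L V x)
      = (LINT x|M. \<psi> (V x) * \<Gamma> (\<lambda>y. (f y)\<^sup>2) V x + (f x)\<^sup>2 * \<psi>' (V x) * \<Gamma> V V x)"
    using parts(3) by simp
  also have "\<dots> \<le> (LINT x|M. \<Gamma> f f x)"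
  proof (rule integral_mono_AE[OF parts(2) Gamma_integrable[OF f f]])
    show "AE x in M. \<psi> (V x) * \<Gamma> (\<lambda>y. (f y)\<^sup>2) V x + (f x)\<^sup>2 * \<psi>' (V x) * \<Gamma> V V x \<le> \<Gamma> f f x"
      using Gamma_quadratic_nonneg[OF f V] Gamma_derivation[OF f f V] Gamma_nonneg[OF V]
    proof eventually_elim
      case (elim x)
      have "(f x)\<^sup>2 * \<psi>' (V x) * \<Gamma> V V x \<le> (f x)\<^sup>2 * - (\<psi> (V x))\<^sup>2 * \<Gamma> V V x"
        using elim riccati rng by (intro mult_right_mono mult_left_mono) auto
      moreover have "\<Gamma> (\<lambda>y. (f y)\<^sup>2) V x = 2 * f x * \<Gamma> f V x"
        using elim by (simp add: power2_eq_square)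
      ultimately show ?case
        using elim(1)[rule_format, of "- (f x * \<psi> (V x))"] by (simp add: power_mult_distrib algebra_simps)
    qed
  qed
  finally show ?thesis .
qed

end

section \<open>The cutoff weight replacing \<open>1 / v\<close>\<close>

lemma has_real_derivative_max_0_square:
  "((\<lambda>y. (max 0 y)\<^sup>2) has_real_derivative 2 * max 0 y) (at y)" for y :: real
proof -
  consider "y < 0" | "y > 0" | "y = 0" by linarith
  then show ?thesis
  proof cases
    case 1
    have "((\<lambda>y. 0) has_real_derivative 2 * max 0 y) (at y)"
      using 1 by (simp add: max_def)
    then show ?thesis
      by (rule has_field_derivative_transform_within_open[of _ _ _ "{..<0}"]) (use 1 in auto)
  next
    case 2
    have "((\<lambda>y. y\<^sup>2) has_real_derivative 2 * max 0 y) (at y)"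
      using 2 by (auto intro!: derivative_eq_intros)
    then show ?thesis
      by (rule has_field_derivative_transform_within_open[of _ _ _ "{0<..}"]) (use 2 in auto)
  next
    case 3
    \<comment> \<open>At the kink the square makes the difference quotient at most
      \<open>\<bar>h\<bar>\<close> in size; this is why the cutoff is \<open>C^1\<close>.\<close>
    have "((\<lambda>h::real. (max 0 h)\<^sup>2 / h) \<longlongrightarrow> 0) (at 0)"
    proof (rule Lim_null_comparison)
      have "norm ((max 0 h)\<^sup>2 / h) \<le> \<bar>h\<bar>" for h :: real
        by (cases "h > 0") (auto simp: power2_eq_square max_def)
      then show "\<forall>\<^sub>F h in at 0. norm ((max 0 h)\<^sup>2 / h) \<le> \<bar>h\<bar>" by simp
    qed (auto intro!: tendsto_eq_intros)
    then show ?thesis using 3 by (simp add: DERIV_def)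
  qed
qed

text \<open>
  A \<open>C\<^sup>1\<close> weight that increases to \<open>1 / v\<close> as \<open>n\<close> grows, vanishes for \<open>v \<ge> n\<close> and, like \<open>1 / v\<close>
  itself, satisfies the differential inequality \<open>\<psi>' \<le> - \<psi>\<^sup>2\<close> under which the Lyapunov term is
  controlled by \<open>\<Gamma> f\<close> without loss.
\<close>

definition cutoff_inverse :: "real \<Rightarrow> real \<Rightarrow> real" where
  "cutoff_inverse n v = (max 0 (1 - v / n))\<^sup>2 / v"

definition cutoff_inverse_deriv :: "real \<Rightarrow> real \<Rightarrow> real" where
  "cutoff_inverse_deriv n v = - (max 0 (1 - v / n) * (2 * v / n + max 0 (1 - v / n)) / v\<^sup>2)"

lemma cutoff_inverse_has_derivative:
  assumes "v > 0" "n > 0"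
  shows "(cutoff_inverse n has_real_derivative cutoff_inverse_deriv n v) (at v)"
proof -
  have "((\<lambda>v. 1 - v / n) has_real_derivative - (1 / n)) (at v)"
    using assms by (auto intro!: derivative_eq_intros)
  from DERIV_chain2[OF has_real_derivative_max_0_square this]
  have "((\<lambda>v. (max 0 (1 - v / n))\<^sup>2) has_real_derivative 2 * max 0 (1 - v / n) * - (1 / n)) (at v)" .
  from DERIV_divide[OF this DERIV_ident] assms
  have "((\<lambda>v. (max 0 (1 - v / n))\<^sup>2 / v) has_real_derivative
      (2 * max 0 (1 - v / n) * - (1 / n) * v - (max 0 (1 - v / n))\<^sup>2 * 1) / (v * v)) (at v)" by simp
  moreover have "(2 * t * - (1 / n) * v - t\<^sup>2 * 1) / (v * v) = - (t * (2 * v / n + t) / v\<^sup>2)" for t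
    using assms by (simp add: field_simps power2_eq_square)
  ultimately show ?thesis
    unfolding cutoff_inverse_def[abs_def] cutoff_inverse_deriv_def by simp
qed

text \<open>With \<open>t = max 0 (1 - v / n)\<close>, and after multiplication by
  \<open>v^2\<close>, the claim is \<open>t^4 \<le> t (2 v / n + t)\<close>. It follows from
  \<open>0 \<le> t \<le> 1\<close> and \<open>2 v / n + t \<ge> 1\<close>, which holds on both sides
  of \<open>v = n\<close>.\<close>

lemma cutoff_inverse_riccati:
  assumes "v > 0" "n > 0"
  shows "cutoff_inverse_deriv n v \<le> - (cutoff_inverse n v)\<^sup>2"
proof -
  define t where "t = max 0 (1 - v / n)"
  have t: "0 \<le> t" "t \<le> 1" "1 \<le> 2 * v / n + t"
    using assms by (auto simp: t_def field_simps max_def)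
  have "t ^ 4 \<le> t ^ 1"
    using t by (intro power_decreasing) auto
  also have "t ^ 1 \<le> t * (2 * v / n + t)"
    using t mult_left_mono[OF t(3) t(1)] by simp
  finally have "t ^ 4 / v\<^sup>2 \<le> t * (2 * v / n + t) / v\<^sup>2"
    by (intro divide_right_mono) auto
  then show ?thesis
    unfolding cutoff_inverse_def cutoff_inverse_deriv_def t_def[symmetric]
    by (simp add: power_divide flip: power_mult)
qed

lemma continuous_on_cutoff_inverse_deriv:
  "n > 0 \<Longrightarrow> continuous_on {1..c} (cutoff_inverse_deriv n)"
  unfolding cutoff_inverse_deriv_def[abs_def] by (intro continuous_intros) auto

lemma cutoff_inverse_bounds:
  assumes "v \<ge> 1" "n > 0"
  shows "0 \<le> cutoff_inverse n v" "cutoff_inverse n v \<le> 1"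
proof -
  have "(max 0 (1 - v / n))\<^sup>2 \<le> 1"
    using assms by (intro power_le_one) (auto simp: field_simps)
  then show "cutoff_inverse n v \<le> 1"
    using assms by (simp add: cutoff_inverse_def field_simps)
qed (use assms in \<open>simp add: cutoff_inverse_def\<close>)

section \<open>The key estimate, by truncation of \<open>W\<close>\<close>

context symmetric_diffusion
begin

text \<open>Since \<open>\<phi>(W) / W\<close> may be unbounded, the estimate is stated for bounded
  measurable minorants \<open>h\<close>, which keep all integrals finite. It is used with a positive
  constant and with a multiple of the indicator of the complement of \<open>A r\<close>.\<close>

lemma integral_lyapunov_weight_le:
  assumes S: "S \<in> sets M" and b: "b \<ge> 0" and W1: "\<And>x. W x \<ge> 1"
    and W: "locally_in_algebra M L \<A> W LW"
    and lyapunov: "AE x in M. LW x \<le> - \<phi> (W x) + b * indicator S x"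
    and h_meas: "h \<in> borel_measurable M" and h_bounded: "bounded (range h)"
    and h_nonneg: "\<And>x. 0 \<le> h x" and h_le: "\<And>x. h x \<le> \<phi> (W x) / W x"
    and f: "f \<in> \<A>"
  shows "(LINT x|M. (f x)\<^sup>2 * h x) \<le> (LINT x|M. \<Gamma> f f x) + b * (LINT x:S|M. (f x)\<^sup>2)"
proof -
  \<comment> \<open>The levels are \<open>Suc n\<close>: the cutoff divides by the level, and a
    level of at least \<open>1\<close> keeps the truncation at least \<open>1\<close>, like
    \<open>W\<close>.\<close>
  obtain V where V: "\<And>n. V n \<in> \<A>"
    and V_eq: "\<And>n x. W x \<le> real (Suc n) \<Longrightarrow> V n x = W x"
    and V_ge: "\<And>n x. W x > real (Suc n) \<Longrightarrow> V n x \<ge> real (Suc n)"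
    and V_L: "\<And>n. AE x in M. W x \<le> real (Suc n) \<longrightarrow> L (V n) x = LW x"
  proof -
    have "\<forall>n. \<exists>V. V \<in> \<A> \<and> (\<forall>x. W x \<le> real (Suc n) \<longrightarrow> V x = W x)
      \<and> (\<forall>x. W x > real (Suc n) \<longrightarrow> V x \<ge> real (Suc n))
      \<and> (AE x in M. W x \<le> real (Suc n) \<longrightarrow> L V x = LW x)"
      using W unfolding locally_in_algebra_def by blast
    from choice[OF this] show ?thesis using that by blast
  qed
  have V1: "V n x \<ge> 1" for n x
    using V_eq[of x n] V_ge[of n x] W1[of x] by (cases "W x \<le> real (Suc n)") auto
  define t where "t n x = max 0 (1 - V n x / real (Suc n))" for n x
  define \<psi> where "\<psi> n x = cutoff_inverse (real (Suc n)) (V n x)" for n x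
  have \<psi>_t: "V n x * \<psi> n x = (t n x)\<^sup>2" for n x
    using V1[of n x] by (simp add: \<psi>_def t_def cutoff_inverse_def)
  have \<psi>01: "0 \<le> \<psi> n x" "\<psi> n x \<le> 1" for n x
    using cutoff_inverse_bounds[OF V1] by (auto simp: \<psi>_def)
  have t01: "0 \<le> t n x" "t n x \<le> 1" for n x
    using V1[of n x] by (auto simp: t_def)
  have t_meas: "t n \<in> borel_measurable M" for n
    unfolding t_def[abs_def] using alg_measurable[OF V] by measurable
  have ff: "(\<lambda>y. (f y)\<^sup>2) \<in> \<A>" using alg_mult[OF f f] by (simp add: power2_eq_square)
  have if2: "integrable M (\<lambda>x. (f x)\<^sup>2)" using alg_integrable[OF ff] .
  have if2h: "integrable M (\<lambda>x. (f x)\<^sup>2 * h x)"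
    using integrable_bounded_mult[OF if2 h_meas h_bounded] by (simp add: mult.commute)
  have if2S: "integrable M (\<lambda>x. indicator S x * (f x)\<^sup>2)"
    using integrable_real_mult_indicator[OF S if2] by (simp add: mult.commute)
  have if2ht: "integrable M (\<lambda>x. (f x)\<^sup>2 * h x * (t n x)\<^sup>2)" for n
  proof -
    have "bounded (range (\<lambda>x. (t n x)\<^sup>2))"
      unfolding bounded_iff using t01 by (intro exI[of _ 1]) (auto intro: power_le_one)
    from integrable_bounded_mult[OF if2h _ this] t_meas show ?thesis
      by (simp add: mult.commute)
  qed
  have bound: "(LINT x|M. (f x)\<^sup>2 * h x * (t n x)\<^sup>2)
      \<le> (LINT x|M. \<Gamma> f f x) + b * (LINT x:S|M. (f x)\<^sup>2)" for n
  proof -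
    obtain c where c: "\<And>x. \<bar>V n x\<bar> \<le> c" using alg_bound[OF V] by blast
    have rng: "V n x \<in> {1..c}" for x using V1[of n x] c[of x] by auto
    let ?\<psi> = "cutoff_inverse (real (Suc n))" and ?\<psi>' = "cutoff_inverse_deriv (real (Suc n))"
    have d: "(?\<psi> has_real_derivative ?\<psi>' v) (at v within {1..c})" if "v \<in> {1..c}" for v
      using that by (intro DERIV_subset[OF cutoff_inverse_has_derivative]) auto
    have co: "continuous_on {1..c} ?\<psi>'" by (rule continuous_on_cutoff_inverse_deriv) simp
    have ri: "?\<psi>' v \<le> - (?\<psi> v)\<^sup>2" if "v \<in> {1..c}" for v
      using that by (intro cutoff_inverse_riccati) auto
    have iL: "integrable M (\<lambda>x. (f x)\<^sup>2 * \<psi> n x * - L (V n) x)"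
      using integral_by_parts_C1(1)[OF ff V rng d co] by (simp add: \<psi>_def)
    have "(LINT x|M. (f x)\<^sup>2 * h x * (t n x)\<^sup>2)
        \<le> (LINT x|M. (f x)\<^sup>2 * \<psi> n x * - L (V n) x + b * (indicator S x * (f x)\<^sup>2))"
    proof (rule integral_mono_AE[OF if2ht])
      show "integrable M (\<lambda>x. (f x)\<^sup>2 * \<psi> n x * - L (V n) x + b * (indicator S x * (f x)\<^sup>2))"
        using iL if2S by (intro Bochner_Integration.integrable_add) auto
      show "AE x in M. (f x)\<^sup>2 * h x * (t n x)\<^sup>2
          \<le> (f x)\<^sup>2 * \<psi> n x * - L (V n) x + b * (indicator S x * (f x)\<^sup>2)"
        using lyapunov V_L[of n]
      proof eventually_elim
        case (elim x)
        \<comment> \<open>Where \<open>V n\<close> reaches the level, the weight vanishes and only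
          the nonnegative \<open>b\<close> term is left. Elsewhere \<open>W\<close> does not exceed
          the level, so \<open>V n\<close> and \<open>L (V n)\<close> agree with \<open>W\<close>
          and \<open>LW\<close> and the Lyapunov condition applies.\<close>
        show ?case
        proof (cases "V n x \<ge> real (Suc n)")
          case True
          then have "t n x = 0" by (simp add: t_def field_simps)
          moreover from this have "\<psi> n x = 0" using \<psi>_t[of n x] V1[of n x] by auto
          ultimately show ?thesis using b by simp
        next
          case False
          then have Wn: "W x \<le> real (Suc n)" using V_ge[of n x] by linarith
          have "h x * W x \<le> \<phi> (W x)"
            using h_le[of x] W1[of x] by (simp add: field_simps)
          also have "\<dots> \<le> - L (V n) x + b * indicator S x"
            using elim Wn by simp
          finally have "h x * W x * \<psi> n x \<le> (- L (V n) x + b * indicator S x) * \<psi> n x"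
            using \<psi>01(1) by (rule mult_right_mono)
          also have "\<dots> \<le> \<psi> n x * - L (V n) x + b * indicator S x"
            using mult_left_mono[OF \<psi>01(2)[of n x], of "b * indicator S x"] b
            by (simp add: algebra_simps)
          finally have "h x * (t n x)\<^sup>2 \<le> \<psi> n x * - L (V n) x + b * indicator S x"
            using \<psi>_t[of n x] V_eq[OF Wn] by (simp add: mult.assoc)
          from mult_left_mono[OF this, of "(f x)\<^sup>2"] show ?thesis
            by (simp add: algebra_simps)
        qed
      qed
    qed
    also have "\<dots> = (LINT x|M. (f x)\<^sup>2 * \<psi> n x * - L (V n) x) + b * (LINT x:S|M. (f x)\<^sup>2)"
      using iL if2S by (subst Bochner_Integration.integral_add) (auto simp: set_lebesgue_integral_def)
    also have "(LINT x|M. (f x)\<^sup>2 * \<psi> n x * - L (V n) x) \<le> (LINT x|M. \<Gamma> f f x)"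
      using integral_L_weight_le_Gamma[OF f V rng d co ri] by (simp add: \<psi>_def)
    finally show ?thesis by simp
  qed
  \<comment> \<open>Once the level exceeds \<open>W x\<close>, \<open>t n x\<close> is explicit in
    \<open>W x\<close> and tends to \<open>1\<close>.\<close>
  have "(\<lambda>n. LINT x|M. (f x)\<^sup>2 * h x * (t n x)\<^sup>2) \<longlonglongrightarrow> (LINT x|M. (f x)\<^sup>2 * h x)"
  proof (rule integral_dominated_convergence)
    show "AE x in M. (\<lambda>n. (f x)\<^sup>2 * h x * (t n x)\<^sup>2) \<longlonglongrightarrow> (f x)\<^sup>2 * h x"
    proof (rule AE_I2)
      fix x
      have "(\<lambda>n. W x / real (Suc n)) \<longlonglongrightarrow> 0"
        using LIMSEQ_Suc[OF lim_const_over_n[of "W x"]] .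
      then have "(\<lambda>n. max 0 (1 - W x / real (Suc n))) \<longlonglongrightarrow> max 0 (1 - 0)"
        by (intro tendsto_intros)
      moreover obtain N where "W x \<le> real N" using real_arch_simple by blast
      then have "\<forall>\<^sub>F n in sequentially. max 0 (1 - W x / real (Suc n)) = t n x"
        using V_eq[of x] by (intro eventually_sequentiallyI[of N]) (auto simp: t_def)
      ultimately have "(\<lambda>n. t n x) \<longlonglongrightarrow> max 0 (1 - 0)"
        by (rule Lim_transform_eventually)
      then have "(\<lambda>n. (f x)\<^sup>2 * h x * (t n x)\<^sup>2) \<longlonglongrightarrow> (f x)\<^sup>2 * h x * (max 0 (1 - 0))\<^sup>2"
        by (intro tendsto_intros)
      then show "(\<lambda>n. (f x)\<^sup>2 * h x * (t n x)\<^sup>2) \<longlonglongrightarrow> (f x)\<^sup>2 * h x"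
        by simp
    qed
    show "AE x in M. norm ((f x)\<^sup>2 * h x * (t n x)\<^sup>2) \<le> (f x)\<^sup>2 * h x" for n
      using t01[of n] h_nonneg by (auto simp: abs_mult intro!: mult_left_le power_le_one)
  qed (use if2h if2ht in auto)
  then show ?thesis
    by (rule LIMSEQ_le_const2) (use bound in auto)
qed

end

section \<open>From the key estimate to the super Poincare inequality\<close>

lemma ennreal_inverse_antimono:
  "a \<le> b \<Longrightarrow> inverse b \<le> inverse a" for a b :: ennreal
  by (simp add: less_eq_ennreal.rep_eq inverse_ennreal.rep_eq ereal_inverse_antimono)

text \<open>Superlinear growth bounds the quotient below by \<open>1\<close> from some point on;
  before that point \<open>\<phi> w \<ge> \<phi> 1\<close> while \<open>w\<close> is bounded. This
  makes \<open>G\<close> finite.\<close>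

lemma superlinear_lower_bound:
  assumes "superlinear \<phi>"
  obtains m where "m > 0" "\<And>w. w \<ge> 1 \<Longrightarrow> m \<le> \<phi> w / w"
proof -
  have pos: "\<phi> 1 > 0" and mono: "mono_on {1..} \<phi>" and "filterlim (\<lambda>w. \<phi> w / w) at_top at_top"
    using assms by (auto simp: superlinear_def)
  then have "eventually (\<lambda>w. 1 \<le> \<phi> w / w) at_top"
    by (simp add: filterlim_at_top)
  then obtain N where N: "\<And>w. w \<ge> N \<Longrightarrow> 1 \<le> \<phi> w / w"
    unfolding eventually_at_top_linorder by blast
  define K where "K = max 1 N"
  show ?thesis
  proof (rule that[of "min 1 (\<phi> 1 / K)"])
    show "min 1 (\<phi> 1 / K) > 0" using pos by (simp add: K_def)
    fix w :: real assume w: "w \<ge> 1"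
    show "min 1 (\<phi> 1 / K) \<le> \<phi> w / w"
    proof (cases "w \<ge> N")
      case True
      then show ?thesis using N by force
    next
      case False
      have "\<phi> 1 / K \<le> \<phi> 1 / w"
        using False w pos by (intro divide_left_mono) (auto simp: K_def)
      also have "\<dots> \<le> \<phi> w / w"
        using w mono_onD[OF mono, of 1 w] by (intro divide_right_mono) auto
      finally show ?thesis by simp
    qed
  qed
qed

theorem theorem3p6:
  fixes \<mu> :: "'a::polish_space measure"
    and D \<A> :: "('a \<Rightarrow> real) set"
    and L :: "('a \<Rightarrow> real) \<Rightarrow> 'a \<Rightarrow> real"
    and A :: "real \<Rightarrow> 'a set"
    and W LW :: "'a \<Rightarrow> real"
    and \<phi> Ginv :: "real \<Rightarrow> real"
    and \<beta>loc :: "real \<Rightarrow> real \<Rightarrow> real"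
    and r0 b :: real
  assumes diffusion: "symmetric_diffusion \<mu> D L \<A>"
    and A_measurable: "\<And>r. 0 \<le> r \<Longrightarrow> A r \<in> sets \<mu>"
    and A_increasing: "mono_on {0..} A"
    and A_exhausting: "(\<Union>r\<in>{0..}. A r) = UNIV"
    and r0: "r0 > 0"
    and b: "b > 0"
    and \<phi>: "superlinear \<phi>"
    and W_ge_1: "\<And>x. W x \<ge> 1"
    and W_smooth: "locally_in_algebra \<mu> L \<A> W LW"
    and W_bounded: "bdd_above (W ` A r0)"
    and lyapunov: "AE x in \<mu>. LW x \<le> - \<phi> (W x) + b * indicator (A r0) x"
    and \<beta>loc_decreasing: "\<And>r. 0 \<le> r \<Longrightarrow> antimono_on {0<..} (\<beta>loc r)"
    and local_super_poincare: "\<And>r s f. 0 \<le> r \<Longrightarrow> s > 0 \<Longrightarrow> f \<in> \<A> \<Longrightarrow>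
      (LINT x:A r|\<mu>. (f x)\<^sup>2)
        \<le> s * (LINT x|\<mu>. carre_du_champ L f f x) + \<beta>loc r s * (LINT x:A r|\<mu>. \<bar>f x\<bar>)\<^sup>2"
    and G_tendsto_0: "(rate_G \<phi> W A \<longlongrightarrow> 0) at_top"
    and Ginv: "inverse_from r0 (rate_G \<phi> W A) Ginv"
  shows "let c = const_c \<phi> W b (A r0);
             \<beta> = (\<lambda>s. c * \<beta>loc (Ginv s) (s / c))
         in \<forall>s>0. \<forall>f\<in>\<A>.
              (LINT x|\<mu>. (f x)\<^sup>2)
                \<le> 2 * s * (LINT x|\<mu>. carre_du_champ L f f x) + \<beta> s * (LINT x|\<mu>. \<bar>f x\<bar>)\<^sup>2"
proof -
  interpret symmetric_diffusion \<mu> D L \<A> by (rule diffusion)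
  define c where "c = const_c \<phi> W b (A r0)"
  obtain m where m: "m > 0" "\<And>w. w \<ge> 1 \<Longrightarrow> m \<le> \<phi> w / w"
    using superlinear_lower_bound[OF \<phi>] by blast
  note weight = integral_lyapunov_weight_le[OF A_measurable[of r0] less_imp_le[OF b] W_ge_1 W_smooth lyapunov]
  have one: "(\<lambda>_. 1) \<in> \<A>" by (rule alg_const)
  have Gamma_one: "(LINT x|\<mu>. \<Gamma> (\<lambda>_. 1) (\<lambda>_. 1) x) = 0"
  proof -
    have "AE x in \<mu>. \<Gamma> (\<lambda>_. 1) (\<lambda>_. 1) x = 0"
      using L_one by eventually_elim (simp add: carre_du_champ_def)
    then show ?thesis by (rule integral_eq_zero_AE)
  qed
  have measure_set: "(LINT x:A r|\<mu>. 1) = measure \<mu> (A r)" if "0 \<le> r" for r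
    using A_measurable[OF that] by (simp add: set_lebesgue_integral_def)
  \<comment> \<open>The minorant \<open>m\<close> and \<open>f = 1\<close> reduce the key estimate
    to \<open>m \<le> b * measure \<mu> (A r0)\<close>.\<close>
  have A0_pos: "measure \<mu> (A r0) > 0"
  proof -
    have "(LINT x|\<mu>. 1\<^sup>2 * m) \<le> (LINT x|\<mu>. \<Gamma> (\<lambda>_. 1) (\<lambda>_. 1) x) + b * (LINT x:A r0|\<mu>. 1\<^sup>2)"
      using r0 m W_ge_1 by (intro weight one) auto
    then have "m \<le> b * measure \<mu> (A r0)"
      using Gamma_one measure_set[of r0] r0 by (simp add: prob_space)
    then have "0 < b * measure \<mu> (A r0)"
      using m(1) by linarith
    then show ?thesis using b by (simp add: zero_less_mult_iff)
  qed
  \<comment> \<open>\<open>enn2real\<close> loses nothing here, since \<open>G\<close> is bounded by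
    \<open>1 / m\<close>.\<close>
  define g where "g r = enn2real (rate_G \<phi> W A r)" for r
  have rate_le: "rate_G \<phi> W A r \<le> ennreal (1 / m)" for r
  proof -
    have "ennreal m \<le> inf_outside \<phi> W (A r)"
      unfolding inf_outside_def using m W_ge_1 by (intro INF_greatest ennreal_leI) auto
    from ennreal_inverse_antimono[OF this] m(1) show ?thesis
      by (simp add: rate_G_def inverse_ennreal inverse_eq_divide)
  qed
  have g_eq: "rate_G \<phi> W A r = ennreal (g r)" for r
    using rate_le[of r] by (auto simp: g_def ennreal_enn2real_if top_unique)
  have g_nonneg: "g r \<ge> 0" for r by (simp add: g_def)
  have g_outside: "1 \<le> g r * (\<phi> (W x) / W x)" if "x \<notin> A r" for r x
  proof -
    have q: "\<phi> (W x) / W x > 0" using m W_ge_1[of x] by (meson less_le_trans)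
    have "inf_outside \<phi> W (A r) \<le> ennreal (\<phi> (W x) / W x)"
      unfolding inf_outside_def using that by (intro INF_lower) auto
    from ennreal_inverse_antimono[OF this] q
    have "ennreal (inverse (\<phi> (W x) / W x)) \<le> ennreal (g r)"
      unfolding g_eq[symmetric] rate_G_def by (simp only: inverse_ennreal)
    then have "inverse (\<phi> (W x) / W x) \<le> g r"
      using g_nonneg by (simp only: ennreal_le_iff)
    from mult_right_mono[OF this, of "\<phi> (W x) / W x"] q left_inverse[of "\<phi> (W x) / W x"]
    show ?thesis by linarith
  qed
  have g_antimono: "g r \<le> g r0" if "r0 \<le> r" for r
  proof -
    have "A r0 \<subseteq> A r" using that r0 by (intro mono_onD[OF A_increasing]) auto
    then have "inf_outside \<phi> W (A r0) \<le> inf_outside \<phi> W (A r)"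
      unfolding inf_outside_def by (intro INF_superset_mono) auto
    from ennreal_inverse_antimono[OF this] have "ennreal (g r) \<le> ennreal (g r0)"
      unfolding g_eq[symmetric] rate_G_def .
    then show ?thesis using g_nonneg by simp
  qed
  \<comment> \<open>On the nonempty set \<open>A r0\<close> the supremum of \<open>W\<close> is at
    least \<open>1\<close>. It must also be finite, because \<open>enn2real\<close> sends
    \<open>\<infinity>\<close> to \<open>0\<close>.\<close>
  have c_ge: "1 + b * g r0 \<le> c"
  proof -
    obtain x0 where x0: "x0 \<in> A r0" using A0_pos by fastforce
    obtain B where B: "\<And>x. x \<in> A r0 \<Longrightarrow> W x \<le> B" using W_bounded by (auto simp: bdd_above_def)
    let ?S = "SUP x\<in>A r0. ennreal (W x)"
    have "1 \<le> ennreal (W x0)" using W_ge_1[of x0] ennreal_leI[of 1 "W x0"] by simp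
    also have "\<dots> \<le> ?S" using x0 by (rule SUP_upper)
    finally have S1: "1 \<le> ?S" .
    have "?S \<le> ennreal B" using B by (intro SUP_least ennreal_leI) auto
    then have S_fin: "?S < \<top>" by (simp add: le_less_trans)
    have eq: "ennreal b * ?S / inf_outside \<phi> W (A r0) = ennreal b * ?S * ennreal (g r0)"
      unfolding g_eq[symmetric] rate_G_def by (simp add: divide_ennreal_def)
    have "ennreal b * 1 * ennreal (g r0) \<le> ennreal b * ?S * ennreal (g r0)"
      using S1 by (intro mult_mono) auto
    moreover have "ennreal b * ?S * ennreal (g r0) < \<top>"
      using S_fin by (simp add: ennreal_mult_less_top)
    ultimately have "enn2real (ennreal b * 1 * ennreal (g r0)) \<le> enn2real (ennreal b * ?S * ennreal (g r0))"
      by (rule enn2real_mono)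
    then show ?thesis
      using b g_nonneg by (simp add: c_def const_c_def eq enn2real_mult)
  qed
  then have c_pos: "c > 0" using b g_nonneg[of r0] by (smt (verit) mult_nonneg_nonneg)
  have "(LINT x|\<mu>. (f x)\<^sup>2) \<le> 2 * s * (LINT x|\<mu>. \<Gamma> f f x)
      + c * \<beta>loc (Ginv s) (s / c) * (LINT x|\<mu>. \<bar>f x\<bar>)\<^sup>2" if s: "s > 0" and f: "f \<in> \<A>" for s f
  proof -
    define r where "r = Ginv s"
    have r: "r0 \<le> r" "rate_G \<phi> W A r \<le> ennreal s"
      using Ginv s by (auto simp: inverse_from_def r_def)
    then have gs: "g r \<le> s" using s by (simp add: g_eq)
    have r_pos: "0 \<le> r" using r r0 by simp
    note Ar = A_measurable[OF r_pos]
    have sub: "A r0 \<subseteq> A r" using r r0 by (intro mono_onD[OF A_increasing]) auto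
    define E where "E = (LINT x|\<mu>. \<Gamma> f f x)"
    define \<beta> where "\<beta> = \<beta>loc r (s / c)"
    have E: "E \<ge> 0" unfolding E_def using Gamma_nonneg[OF f] by (rule integral_nonneg_AE)
    have ff: "(\<lambda>y. (f y)\<^sup>2) \<in> \<A>" using alg_mult[OF f f] by (simp add: power2_eq_square)
    have if2: "integrable \<mu> (\<lambda>x. (f x)\<^sup>2)" using alg_integrable[OF ff] .
    have if2S: "integrable \<mu> (\<lambda>x. indicator S x * (f x)\<^sup>2)" if "S \<in> sets \<mu>" for S
      using integrable_real_mult_indicator[OF that if2] by (simp add: mult.commute)
    define I where "I = (LINT x:A r|\<mu>. (f x)\<^sup>2)"
    have I0: "I \<ge> 0" unfolding I_def set_lebesgue_integral_def by (rule integral_nonneg_AE) auto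
    have I_r0: "(LINT x:A r0|\<mu>. (f x)\<^sup>2) \<le> I"
      unfolding I_def set_lebesgue_integral_def
      using if2S[OF Ar] if2S[OF A_measurable[of r0]] r0 sub
      by (intro integral_mono) (auto simp: indicator_def)
    have outside: "(LINT x|\<mu>. (f x)\<^sup>2 * indicator (- A r) x) \<le> g r * (E + b * I)"
    \<comment> \<open>The main case divides by \<open>g r\<close>. If \<open>g r = 0\<close>, then
      \<open>g_outside\<close> leaves no point outside \<open>A r\<close>.\<close>
    proof (cases "g r = 0")
      case True
      then have "A r = UNIV" using g_outside[of _ r] by fastforce
      then show ?thesis using True by simp
    next
      case False
      then have gpos: "g r > 0" using g_nonneg[of r] by simp
      \<comment> \<open>By \<open>g_outside\<close> this is a minorant of
        \<open>\<phi>(W) / W\<close>; multiplying the resulting estimate by \<open>g r\<close> gives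
        the bound on the complement of \<open>A r\<close>.\<close>
      let ?h = "\<lambda>x. indicator (- A r) x / g r"
      have Cm: "- A r \<in> sets \<mu>" using Ar sets_borel by auto
      have "(LINT x|\<mu>. (f x)\<^sup>2 * ?h x) \<le> E + b * (LINT x:A r0|\<mu>. (f x)\<^sup>2)"
        unfolding E_def
      proof (rule weight)
        show "?h \<in> borel_measurable \<mu>" using Cm by measurable
        show "bounded (range ?h)"
          unfolding bounded_iff using gpos
          by (intro exI[of _ "1 / g r"]) (auto simp: indicator_def)
        show "?h x \<le> \<phi> (W x) / W x" for x
        proof (cases "x \<in> A r")
          case True
          then show ?thesis using m(2)[OF W_ge_1[of x]] m(1) by simp
        next
          case False
          then show ?thesis using g_outside[OF False] gpos by (simp add: field_simps)
        qed
      qed (use r0 gpos f in auto)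
      also have "\<dots> \<le> E + b * I" using I_r0 b by simp
      finally show ?thesis using gpos by (simp add: field_simps)
    qed
    have "(LINT x|\<mu>. (f x)\<^sup>2) = (LINT x|\<mu>. indicator (A r) x * (f x)\<^sup>2 + (f x)\<^sup>2 * indicator (- A r) x)"
      by (intro Bochner_Integration.integral_cong) (auto simp: indicator_def)
    also have "\<dots> = I + (LINT x|\<mu>. (f x)\<^sup>2 * indicator (- A r) x)"
      unfolding I_def set_lebesgue_integral_def
      using if2S[OF Ar] if2S[of "- A r"] Ar sets_borel
      by (subst Bochner_Integration.integral_add) (auto simp: mult.commute)
    also have "\<dots> \<le> I + g r * (E + b * I)" using outside by simp
    also have "\<dots> = (1 + b * g r) * I + g r * E" by (simp add: algebra_simps)
    \<comment> \<open>The constant \<open>c\<close> is built from \<open>r0\<close>, which suffices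
      because \<open>g r \<le> g r0\<close>. The choice \<open>r = Ginv s\<close> gives
      \<open>g r \<le> s\<close>, one half of the factor \<open>2 * s\<close>.\<close>
    also have "\<dots> \<le> c * I + s * E"
    proof (intro add_mono mult_right_mono)
      have "b * g r \<le> b * g r0" using g_antimono[OF r(1)] b by simp
      then show "1 + b * g r \<le> c" using c_ge by simp
    qed (use I0 E gs in auto)
    \<comment> \<open>At the parameter \<open>s / c\<close> the factor \<open>c\<close> cancels in
      the energy term, which contributes the other \<open>s\<close>.\<close>
    also have "c * I \<le> c * (s / c * E + \<beta> * (LINT x:A r|\<mu>. \<bar>f x\<bar>)\<^sup>2)"
      using local_super_poincare[OF r_pos _ f, of "s / c"] s c_pos
      unfolding I_def E_def \<beta>_def by (intro mult_left_mono) auto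
    also have "\<dots> \<le> c * (s / c * E + \<beta> * (LINT x|\<mu>. \<bar>f x\<bar>)\<^sup>2)"
    proof (intro mult_left_mono add_left_mono power_mono)
      show "(LINT x:A r|\<mu>. \<bar>f x\<bar>) \<le> (LINT x|\<mu>. \<bar>f x\<bar>)"
        unfolding set_lebesgue_integral_def
        using alg_integrable[OF f] integrable_real_mult_indicator[OF Ar, of "\<lambda>x. \<bar>f x\<bar>"]
        by (intro integral_mono) (auto simp: indicator_def mult.commute)
      show "0 \<le> (LINT x:A r|\<mu>. \<bar>f x\<bar>)"
        unfolding set_lebesgue_integral_def by (rule integral_nonneg_AE) auto
      show "0 \<le> \<beta>"
      proof -
        have pos: "measure \<mu> (A r) > 0"
          using A0_pos finite_measure_mono[OF sub Ar] by linarith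
        have "measure \<mu> (A r) \<le> \<beta> * (measure \<mu> (A r))\<^sup>2"
          using local_super_poincare[OF r_pos _ one, of "s / c"] s c_pos
          by (simp add: Gamma_one measure_set[OF r_pos] \<beta>_def)
        with pos have "0 < \<beta> * (measure \<mu> (A r))\<^sup>2" by linarith
        then show ?thesis using pos by (simp add: zero_less_mult_iff)
      qed
    qed (use c_pos in auto)
    finally show ?thesis
      using c_pos by (simp add: E_def \<beta>_def r_def algebra_simps)
  qed
  then show ?thesis
    unfolding Let_def c_def by blast
qed

end
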